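(* Let $K$ be a field, $A$ a free abelian group of finite rank $r$, and $W:A\to K$ an elliptic net. Let $\mathscr B=\{\mathbf b_1,\dots,\mathbf b_r\}$ be a basis of $A$, and assume that $W$ has a unique rank of apparition with respect to $\mathscr B$. Let $\Lambda=W^{-1}(0)=\{\mathbf v\in A: W(\mathbf v)=0\}$. Then $\Lambda$ is a full rank subgroup of $A$.
   Context: An elliptic net is a map $W:A\to K$ with $W(\mathbf 0)=0$ and $W(\mathbf p+\mathbf q+\mathbf s)W(\mathbf p-\mathbf q)W(\mathbf r+\mathbf s)W(\mathbf r)+W(\mathbf q+\mathbf r+\mathbf s)W(\mathbf q-\mathbf r)W(\mathbf p+\mathbf s)W(\mathbf p)+W(\mathbf r+\mathbf p+\mathbf s)W(\mathbf r-\mathbf p)W(\mathbf q+\mathbf s)W(\mathbf q)=0$ for all $\mathbf p,\mathbf q,\mathbf r,\mathbf s\in A$. $W$ has a unique rank of apparition with respect to $\mathscr B$ if there are integers $\rho_1,\dots,\rho_r$ with $\rho_i>1$ such that for all $1\le i\le r$ and all $n\in\mathbb Z$: $W(n\mathbf b_i)=0\iff\rho_i\mid n$. *)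

theory Defs
  imports Complex_Main
begin

text \<open>The integer multiple \<open>n \<cdot> x\<close>; at least one of \<open>nat n\<close> and \<open>nat (- n)\<close> is \<open>0\<close>.\<close>

definition zmul :: "int \<Rightarrow> 'a::ab_group_add \<Rightarrow> 'a" where
  "zmul n x = ((\<lambda>y. x + y) ^^ nat n) 0 - ((\<lambda>y. x + y) ^^ nat (- n)) 0"

lemma zmul_0 [simp]: "zmul 0 x = 0"
  by (simp add: zmul_def)

lemma zmul_add_1: "zmul (n + 1) x = x + zmul n x"
proof (cases "n \<ge> 0")
  case True
  then show ?thesis
    by (simp add: zmul_def nat_add_distrib algebra_simps)
next
  case False
  then have "nat (- n) = Suc (nat (- (n + 1)))" by simp
  with False show ?thesis
    by (simp add: zmul_def)
qed

lemma zmul_diff_1: "zmul (n - 1) x = zmul n x - x"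
  using zmul_add_1 [of "n - 1" x] by simp

text \<open>The library's \<open>independent\<close> and \<open>span\<close> for the \<open>\<int>\<close>-module underlying an abelian group.\<close>

global_interpretation zmod: module "zmul :: int \<Rightarrow> 'a::ab_group_add \<Rightarrow> 'a"
proof
  show left: "zmul (a + b) x = zmul a x + zmul b x" for a b and x :: 'a
  proof (induction a rule: int_induct [where k = 0])
    case (step1 i)
    have "zmul (i + 1 + b) x = zmul (i + b + 1) x" by (simp add: ac_simps)
    also have "\<dots> = x + zmul (i + b) x" by (rule zmul_add_1)
    also have "\<dots> = zmul (i + 1) x + zmul b x" using step1 by (simp add: zmul_add_1 add.assoc)
    finally show ?case .
  next
    case (step2 i)
    have "zmul (i - 1 + b) x = zmul (i + b - 1) x" by (simp add: algebra_simps)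
    also have "\<dots> = zmul (i + b) x - x" by (rule zmul_diff_1)
    also have "\<dots> = zmul (i - 1) x + zmul b x" using step2 by (simp add: zmul_diff_1)
    finally show ?case .
  qed simp
  show "zmul a (x + y) = zmul a x + zmul a y" for a and x y :: 'a
    by (induction a rule: int_induct [where k = 0])
      (simp_all add: zmul_add_1 zmul_diff_1 algebra_simps)
  show one: "zmul 1 x = x" for x :: 'a
    using zmul_add_1 [of 0 x] by simp
  show "zmul a (zmul b x) = zmul (a * b) x" for a b and x :: 'a
  proof (induction a rule: int_induct [where k = 0])
    case (step1 i)
    then show ?case by (simp add: distrib_right left one)
  next
    case (step2 i)
    have "zmul (i * b) x = zmul ((i - 1) * b) x + zmul b x"
      unfolding left [symmetric] by (simp add: left_diff_distrib)
    then show ?case using step2 by (simp add: zmul_diff_1)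
  qed simp
qed

definition add_subgroup :: "'a::ab_group_add set \<Rightarrow> bool" where
  "add_subgroup H \<longleftrightarrow> 0 \<in> H \<and> (\<forall>x\<in>H. \<forall>y\<in>H. x + y \<in> H) \<and> (\<forall>x\<in>H. - x \<in> H)"

definition zbasis :: "'a::ab_group_add set \<Rightarrow> 'a set \<Rightarrow> bool" where
  "zbasis B H \<longleftrightarrow> zmod.independent B \<and> zmod.span B = H"

definition free_abelian_of_rank :: "'a::ab_group_add set \<Rightarrow> nat \<Rightarrow> bool" where
  "free_abelian_of_rank H r \<longleftrightarrow> (\<exists>B. zbasis B H \<and> finite B \<and> card B = r)"

definition elliptic_net :: "('a::ab_group_add \<Rightarrow> 'k::field) \<Rightarrow> bool" where
  "elliptic_net W \<longleftrightarrow> W 0 = 0 \<and>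
     (\<forall>p q r s.
        W (p + q + s) * W (p - q) * W (r + s) * W r
      + W (q + r + s) * W (q - r) * W (p + s) * W p
      + W (r + p + s) * W (r - p) * W (q + s) * W q = 0)"

definition unique_rank_of_apparition ::
    "('a::ab_group_add \<Rightarrow> 'k::field) \<Rightarrow> 'a set \<Rightarrow> bool" where
  "unique_rank_of_apparition W B \<longleftrightarrow>
     (\<exists>\<rho> :: 'a \<Rightarrow> int. \<forall>b\<in>B. \<rho> b > 1 \<and> (\<forall>n. W (zmul n b) = 0 \<longleftrightarrow> \<rho> b dvd n))"

end

theory Submission
  imports Defs
begin

text \<open>
  If \<open>x, y\<close> are zeros of an elliptic net and \<open>2x = m + n\<close> for two non-zeros \<open>m, n\<close>, then the
  recurrence with \<open>p = x\<close>, \<open>q = - y\<close>, \<open>r = m\<close>, \<open>s = - 2x\<close> collapses to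
  \<open>W (x + y)\<^sup>2 * W m * W n = 0\<close> up to sign, so \<open>x + y\<close> is a zero. For a zero \<open>x\<close> in
  \<open>\<int> b\<close> with \<open>b\<close> in the basis one can take \<open>m = b\<close>, so \<open>x\<close> is a period of the zero set.
  The property that all zeros in a subgroup are periods passes from two subgroups to their sum,
  since \<open>2(h + k)\<close> can always be split suitably; hence all zeros are periods. The rank is full
  because the zero set contains a positive multiple of every basis element.
\<close>

section \<open>Zeros of elliptic nets and their periods\<close>

lemma elliptic_netD:
  assumes "elliptic_net W"
  shows "W (p + q + s) * W (p - q) * W (r + s) * W r
      + W (q + r + s) * W (q - r) * W (p + s) * W p
      + W (r + p + s) * W (r - p) * W (q + s) * W q = 0"
  using assms by (simp add: elliptic_net_def)

lemma elliptic_net_zero: "elliptic_net W \<Longrightarrow> W 0 = 0"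
  by (simp add: elliptic_net_def)

lemma elliptic_net_uminus:
  assumes "elliptic_net W"
  shows "W (- x) = - W x"
proof -
  \<comment> \<open>Applying this at \<open>x\<close> and at \<open>- x\<close> also covers
    \<open>W x = 0\<close>, where it gives \<open>W (- x) = 0\<close>.\<close>
  have "W x * W x * W x * (W x + W (- x)) = 0" for x
    using elliptic_netD [OF assms, of x x 0 0] elliptic_net_zero [OF assms]
    by (simp add: algebra_simps)
  from this [of x] this [of "- x"] show ?thesis
    by (auto simp: eq_neg_iff_add_eq_0 add.commute)
qed

lemma elliptic_net_zero_add:
  assumes W: "elliptic_net W"
    and "W x = 0" "W y = 0" "x + x = m + n" "W m \<noteq> 0" "W n \<noteq> 0"
  shows "W (x + y) = 0"
proof -
  \<comment> \<open>The second and third terms of the recurrence contain \<open>W p = W x\<close>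
    and \<open>W q = W (- y)\<close>, so only the first survives.\<close>
  have "x + - y + - (m + n) = - (x + y)"
    unfolding assms(4) [symmetric] by (simp add: algebra_simps)
  moreover have "m + - (m + n) = - n" by simp
  ultimately show ?thesis
    using elliptic_netD [OF W, of x "- y" "- (m + n)" m] assms
    by (simp only: elliptic_net_uminus [OF W] diff_minus_eq_add) simp
qed

text \<open>Only \<open>x\<close> is confined to \<open>S\<close>; \<open>y\<close> ranges over the
  zeros in the whole group, so that periods from different subgroups can be combined.\<close>

definition zeros_periodic_on :: "('a::ab_group_add \<Rightarrow> 'k::field) \<Rightarrow> 'a set \<Rightarrow> bool" where
  "zeros_periodic_on W S \<longleftrightarrow> (\<forall>x\<in>S. W x = 0 \<longrightarrow> (\<forall>y. W y = 0 \<longrightarrow> W (x + y) = 0))"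

lemma zeros_periodic_onD:
  "\<lbrakk>zeros_periodic_on W S; x \<in> S; W x = 0; W y = 0\<rbrakk> \<Longrightarrow> W (x + y) = 0"
  by (auto simp: zeros_periodic_on_def)

text \<open>Translation by \<open>x\<close> is undone by \<open>- x\<close>, again a zero in
  \<open>S\<close>; so non-zeros are preserved as well.\<close>

lemma zeros_periodic_on_add_iff:
  assumes "elliptic_net W" "zmod.subspace S" "zeros_periodic_on W S" "x \<in> S" "W x = 0"
  shows "W (x + y) = 0 \<longleftrightarrow> W y = 0"
proof
  assume "W (x + y) = 0"
  moreover have "- x \<in> S" "W (- x) = 0"
    using assms by (simp_all add: zmod.subspace_neg elliptic_net_uminus)
  ultimately have "W (- x + (x + y)) = 0"
    using assms(3) zeros_periodic_onD by blast
  then show "W y = 0" by (simp only: minus_add_cancel)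
qed (use assms zeros_periodic_onD in blast)

text \<open>The double of \<open>h + k\<close> splits into \<open>h + h\<close> and
  \<open>k + k\<close> if \<open>W\<close> vanishes at neither. If, say,
  \<open>W (h + h) = 0\<close>, it splits into \<open>k\<close> and \<open>h + h + k\<close>, unless
  \<open>W k = 0\<close>; then \<open>h\<close> is a zero too, and \<open>h\<close> and
  \<open>k\<close> are periods separately.\<close>

lemma zeros_periodic_on_sum:
  assumes W: "elliptic_net W"
    and S: "zmod.subspace S" "zeros_periodic_on W S"
    and T: "zmod.subspace T" "zeros_periodic_on W T"
  shows "zeros_periodic_on W {h + k | h k. h \<in> S \<and> k \<in> T}"
proof -
  \<comment> \<open>\<open>S\<close> and \<open>T\<close> are quantified afresh so that they can be
    exchanged for the case \<open>W (k + k) = 0\<close>.\<close>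
  have *: "W (h + k + y) = 0"
    if S: "zmod.subspace S" "zeros_periodic_on W S" and T: "zmod.subspace T" "zeros_periodic_on W T"
      and hk: "h \<in> S" "k \<in> T" "W (h + k) = 0" and y: "W y = 0" and "W (h + h) = 0"
    for S T h k y
  proof (cases "W k = 0")
    case True
    then have "W h = 0"
      using zeros_periodic_on_add_iff [OF W T hk(2)] hk(3) by (metis add.commute)
    moreover have "W (k + y) = 0"
      using True T(2) hk(2) y zeros_periodic_onD by blast
    ultimately show ?thesis
      using zeros_periodic_onD [OF S(2) hk(1)] by (simp add: add.assoc)
  next
    case False
    moreover have "h + h \<in> S" using S(1) hk(1) by (simp add: zmod.subspace_add)
    ultimately have "W (h + h + k) \<noteq> 0"
      using zeros_periodic_on_add_iff [OF W S] \<open>W (h + h) = 0\<close> by blast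
    moreover have "h + k + (h + k) = k + (h + h + k)" by (simp add: ac_simps)
    ultimately show ?thesis
      using elliptic_net_zero_add [OF W hk(3) y] False by blast
  qed
  have "W (h + k + y) = 0"
    if hk: "h \<in> S" "k \<in> T" "W (h + k) = 0" and y: "W y = 0" for h k y
  proof -
    consider "W (h + h) = 0" | "W (k + k) = 0" | "W (h + h) \<noteq> 0" "W (k + k) \<noteq> 0" by blast
    then show ?thesis
    proof cases
      case 1
      then show ?thesis using * S T hk y by blast
    next
      case 2
      then show ?thesis using * [OF T S hk(2,1)] hk(3) y by (simp add: add.commute)
    next
      case 3
      moreover have "h + k + (h + k) = h + h + (k + k)" by (simp add: ac_simps)
      ultimately show ?thesis using elliptic_net_zero_add [OF W hk(3) y] by blast
    qed
  qed
  then show ?thesis by (auto simp: zeros_periodic_on_def)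
qed

lemma zeros_periodic_on_cyclic:
  assumes W: "elliptic_net W" and "\<rho> > 1" and \<rho>: "\<And>n. W (zmul n b) = 0 \<longleftrightarrow> \<rho> dvd n"
  shows "zeros_periodic_on W (zmod.span {b})"
proof -
  have "W (zmul n b + y) = 0" if n: "W (zmul n b) = 0" and y: "W y = 0" for n y
  proof (rule elliptic_net_zero_add [OF W n y])
    \<comment> \<open>As \<open>\<rho> > 1\<close> divides \<open>n\<close>, it divides neither
      \<open>1\<close> nor \<open>n + n - 1\<close>.\<close>
    show "zmul n b + zmul n b = zmul 1 b + zmul (n + n - 1) b"
      unfolding zmod.scale_left_distrib [symmetric] by simp
    show "W (zmul 1 b) \<noteq> 0"
      unfolding \<rho> using \<open>\<rho> > 1\<close> by simp
    have "\<rho> dvd n + n" using n unfolding \<rho> by simp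
    then have "\<not> \<rho> dvd n + n - 1"
      using \<open>\<rho> > 1\<close> by (metis dvd_diff_right_iff zdvd_not_zless zero_less_one)
    then show "W (zmul (n + n - 1) b) \<noteq> 0"
      unfolding \<rho> .
  qed
  then show ?thesis by (auto simp: zeros_periodic_on_def zmod.span_singleton)
qed

text \<open>Induction on \<open>B\<close>: each new element adds a cyclic summand to the
  span.\<close>

lemma zeros_periodic_on_span:
  assumes W: "elliptic_net W" and "finite B" and "unique_rank_of_apparition W B"
  shows "zeros_periodic_on W (zmod.span B)"
proof -
  obtain \<rho> where \<rho>: "\<And>b. b \<in> B \<Longrightarrow> \<rho> b > 1 \<and> (\<forall>n. W (zmul n b) = 0 \<longleftrightarrow> \<rho> b dvd n)"
    using assms(3) unfolding unique_rank_of_apparition_def by blast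
  from \<open>finite B\<close> \<rho> show ?thesis
  proof (induction B)
    case empty
    then show ?case by (simp add: zeros_periodic_on_def)
  next
    case (insert b B)
    then have "zeros_periodic_on W (zmod.span {b})"
      by (intro zeros_periodic_on_cyclic [OF W, of "\<rho> b"]) auto
    then show ?case
      using zeros_periodic_on_sum [OF W zmod.subspace_span _ zmod.subspace_span, of "{b}" B]
        insert zmod.span_Un [of "{b}" B]
      by auto
  qed
qed

section \<open>Full rank subgroups of free abelian groups\<close>

lemma independent_insert_zmultiple:
  assumes "finite C" "zmod.independent C" "C \<subseteq> zmod.span B"
    and "zmod.independent (insert b B)" "finite B" "b \<notin> B"
    and "c - zmul d b \<in> zmod.span B" "d \<noteq> 0"
  shows "c \<notin> C" "zmod.independent (insert c C)"
proof -
  have mult: "k = 0" if k: "zmul k b \<in> zmod.span B" for k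
  proof -
    obtain u where u: "zmul k b = (\<Sum>a\<in>B. zmul (u a) a)"
      using k unfolding zmod.span_finite [OF \<open>finite B\<close>] by blast
    \<comment> \<open>Moving \<open>zmul k b\<close> to the other side gives a relation on
      \<open>insert b B\<close> with coefficient \<open>- k\<close> at \<open>b\<close>.\<close>
    define u' where "u' a = (if a = b then - k else u a)" for a
    have "(\<Sum>a\<in>B. zmul (u' a) a) = (\<Sum>a\<in>B. zmul (u a) a)"
      using \<open>b \<notin> B\<close> by (intro sum.cong) (auto simp: u'_def)
    then have "(\<Sum>a\<in>insert b B. zmul (u' a) a) = 0"
      using assms(5,6) u by (simp add: u'_def)
    then have "u' b = 0"
      using assms(4,5) zmod.dependent_finite [of "insert b B"] by auto
    then show ?thesis by (simp add: u'_def)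
  qed
  have C: "zmod.span C \<subseteq> zmod.span B"
    using assms(3) by (simp add: zmod.span_minimal zmod.subspace_span)
  \<comment> \<open>Over the integers a dependent element need not lie in the span of the others, so
    all multiples of \<open>c\<close> are treated. Modulo \<open>zmod.span B\<close>,
    \<open>zmul k c\<close> is \<open>zmul (k * d) b\<close>.\<close>
  have mult_c: "k = 0" if "zmul k c \<in> zmod.span C" for k
  proof -
    have "zmul (k * d) b = zmul k c - zmul k (c - zmul d b)"
      by (simp add: zmod.scale_right_diff_distrib)
    also have "\<dots> \<in> zmod.span B"
      using zmod.span_diff [OF subsetD [OF C that] zmod.span_scale [OF assms(7)]] .
    finally show ?thesis using mult \<open>d \<noteq> 0\<close> by fastforce
  qed
  show "c \<notin> C"
    using mult_c [of 1] zmod.span_base by fastforce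
  show "zmod.independent (insert c C)"
  proof
    assume "zmod.dependent (insert c C)"
    then obtain u where u: "(\<Sum>a\<in>insert c C. zmul (u a) a) = 0" "\<exists>a\<in>insert c C. u a \<noteq> 0"
      using zmod.dependent_finite [of "insert c C"] \<open>finite C\<close> by auto
    then have "zmul (u c) c = - (\<Sum>a\<in>C. zmul (u a) a)"
      using \<open>finite C\<close> \<open>c \<notin> C\<close> by (simp add: eq_neg_iff_add_eq_0)
    also have "\<dots> \<in> zmod.span C"
      by (intro zmod.span_neg zmod.span_sum zmod.span_scale zmod.span_base)
    finally have "u c = 0" by (rule mult_c)
    then have "(\<Sum>a\<in>C. zmul (u a) a) = 0" "\<exists>a\<in>C. u a \<noteq> 0"
      using u \<open>finite C\<close> \<open>c \<notin> C\<close> by auto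
    then show False
      using assms(1,2) zmod.dependent_finite by blast
  qed
qed

text \<open>Division with remainder: subtracting \<open>zmul q c\<close> from \<open>x\<close>
  leaves an element of \<open>H\<close> with coefficient \<open>k mod d\<close> at \<open>b\<close>
  modulo \<open>zmod.span B\<close>, which is \<open>0\<close> by minimality of
  \<open>d\<close>.\<close>

lemma span_insert_least_multiple:
  assumes H: "zmod.subspace H" "H \<subseteq> zmod.span (insert b B)"
    and C: "zmod.span C = H \<inter> zmod.span B"
    and c: "c \<in> H" "c - zmul d b \<in> zmod.span B" "d > 0"
    and least: "\<And>x e. \<lbrakk>x \<in> H; x - zmul e b \<in> zmod.span B; e > 0\<rbrakk> \<Longrightarrow> d \<le> e"
  shows "zmod.span (insert c C) = H"
proof
  have "C \<subseteq> H" using C zmod.span_superset by blast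
  then show "zmod.span (insert c C) \<subseteq> H"
    using H(1) c(1) by (simp add: zmod.span_minimal)
  show "H \<subseteq> zmod.span (insert c C)"
  proof
    fix x assume "x \<in> H"
    then obtain k where k: "x - zmul k b \<in> zmod.span B"
      using H(2) zmod.span_insert by blast
    define q where "q = k div d"
    have "x - zmul q c - zmul (k mod d) b = x - zmul k b - zmul q (c - zmul d b)"
    proof -
      have "zmul k b = zmul q (zmul d b) + zmul (k mod d) b"
        by (simp add: q_def flip: zmod.scale_left_distrib)
      then show ?thesis by (simp add: zmod.scale_right_diff_distrib algebra_simps)
    qed
    also have "\<dots> \<in> zmod.span B"
      using zmod.span_diff [OF k zmod.span_scale [OF c(2)]] .
    finally have rem: "x - zmul q c - zmul (k mod d) b \<in> zmod.span B" .
    have xq: "x - zmul q c \<in> H"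
      using H(1) \<open>x \<in> H\<close> c(1) by (simp add: zmod.subspace_diff zmod.subspace_scale)
    have "k mod d = 0"
      using least [OF xq rem] pos_mod_bound [OF c(3), of k] pos_mod_sign [OF c(3), of k] by linarith
    with rem xq have "x - zmul q c \<in> zmod.span C"
      by (simp add: C)
    then show "x \<in> zmod.span (insert c C)"
      using zmod.span_insert by blast
  qed
qed

text \<open>Induction on \<open>B\<close>: a basis of \<open>H \<inter> zmod.span B\<close> is
  extended by an element of \<open>H\<close> with least positive coefficient at \<open>b\<close>.
  The multiples of basis elements in \<open>H\<close> ensure that one exists, so every step raises
  the rank by one.\<close>

lemma free_abelian_of_rank_subgroup:
  assumes "finite B" "zmod.independent B" "zmod.subspace H" "H \<subseteq> zmod.span B"
    and "\<And>b. b \<in> B \<Longrightarrow> \<exists>n>0. zmul n b \<in> H"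
  shows "free_abelian_of_rank H (card B)"
  using assms
proof (induction B arbitrary: H)
  case empty
  then have "H = {0}" using zmod.subspace_0 by auto
  then show ?case
    by (auto simp: free_abelian_of_rank_def zbasis_def zmod.independent_empty intro!: exI [of _ "{}"])
next
  case (insert b B)
  note H = insert.prems(2,3)
  have "free_abelian_of_rank (H \<inter> zmod.span B) (card B)"
  proof (rule insert.IH)
    show "zmod.independent B"
      using insert.prems(1) zmod.independent_mono by blast
    show "zmod.subspace (H \<inter> zmod.span B)"
      using H(1) by (simp add: zmod.subspace_inter zmod.subspace_span)
    show "\<exists>n>0. zmul n a \<in> H \<inter> zmod.span B" if "a \<in> B" for a
      using insert.prems(4) [of a] that by (auto simp: zmod.span_base zmod.span_scale)
  qed auto
  then obtain C where C: "zmod.independent C" "zmod.span C = H \<inter> zmod.span B"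
    "finite C" "card C = card B"
    by (auto simp: free_abelian_of_rank_def zbasis_def)
  \<comment> \<open>Natural numbers make \<open>LEAST\<close> well-founded here.\<close>
  let ?P = "\<lambda>n::nat. n > 0 \<and> (\<exists>x\<in>H. x - zmul (int n) b \<in> zmod.span B)"
  obtain n where n: "n > 0" "zmul n b \<in> H" using insert.prems(4) by auto
  then have "?P (nat n)" by (auto intro!: bexI [of _ "zmul n b"] simp: zmod.span_zero)
  define d where "d = (LEAST n. ?P n)"
  have "?P d" unfolding d_def by (rule LeastI, fact)
  then obtain c where c: "c \<in> H" "c - zmul (int d) b \<in> zmod.span B" "int d > 0" by auto
  have least: "int d \<le> e" if "x \<in> H" "x - zmul e b \<in> zmod.span B" "e > 0" for x e
  proof -
    have "?P (nat e)" using that by auto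
    then have "d \<le> nat e" unfolding d_def by (rule Least_le)
    then show ?thesis using \<open>e > 0\<close> by linarith
  qed
  have "C \<subseteq> zmod.span B" using C(2) zmod.span_superset by blast
  note indep = independent_insert_zmultiple [OF C(3,1) this insert.prems(1) insert.hyps c(2)]
  have "zmod.span (insert c C) = H"
    by (rule span_insert_least_multiple [OF H C(2) c least])
  then show ?case
    using indep c(3) C(3,4) insert.hyps
    by (auto simp: free_abelian_of_rank_def zbasis_def intro!: exI [of _ "insert c C"])
qed

section \<open>The zero set as a subgroup of full rank\<close>

lemma add_subgroup_imp_subspace:
  assumes "add_subgroup H"
  shows "zmod.subspace H"
proof -
  have "zmul n x \<in> H" if "x \<in> H" for n x
  proof (induction n rule: int_induct [where k = 0])
    case (step2 i)
    then have "zmul i x + - x \<in> H" using assms that unfolding add_subgroup_def by blast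
    then show ?case by (simp add: zmul_diff_1)
  qed (use assms that in \<open>auto simp: add_subgroup_def zmul_add_1\<close>)
  then show ?thesis
    using assms by (auto simp: add_subgroup_def zmod.subspace_def)
qed

theorem theorem1p9:
  fixes W :: "'a::ab_group_add \<Rightarrow> 'k::field"
    and B :: "'a set"
    and r :: nat
  assumes "free_abelian_of_rank (UNIV :: 'a set) r"
    and "elliptic_net W"
    and "zbasis B UNIV" and "finite B" and "card B = r"
    and "unique_rank_of_apparition W B"
  shows "add_subgroup {v. W v = 0} \<and> free_abelian_of_rank {v. W v = 0} r"
proof
  have B: "zmod.independent B" "zmod.span B = UNIV"
    using assms(3) by (auto simp: zbasis_def)
  then have "zeros_periodic_on W UNIV"
    using zeros_periodic_on_span assms by metis
  then show sub: "add_subgroup {v. W v = 0}"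
    using assms(2)
    by (auto simp: add_subgroup_def zeros_periodic_on_def elliptic_net_zero elliptic_net_uminus)
  have "\<exists>n>0. zmul n b \<in> {v. W v = 0}" if b: "b \<in> B" for b
  proof -
    obtain \<rho> :: "'a \<Rightarrow> int" where "\<rho> b > 1" "\<forall>n. W (zmul n b) = 0 \<longleftrightarrow> \<rho> b dvd n"
      using assms(6) b unfolding unique_rank_of_apparition_def by blast
    then show ?thesis by (intro exI [of _ "\<rho> b"]) simp
  qed
  then show "free_abelian_of_rank {v. W v = 0} r"
    using free_abelian_of_rank_subgroup [OF assms(4) B(1) add_subgroup_imp_subspace [OF sub]]
      B(2) assms(5) by simp
qed

end
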